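(* Let $\mathbb{F}_q$ be an arbitrary finite field with $q$ elements, let $d \ge 1$ be an integer, and let $A \subset \mathbb{F}_q$. (i) If $|A| > q^{\frac{1}{2}+\frac{1}{2d}}$, then $\mathbb{F}_q^{*} \subset dA^2$. (ii) Let $C_{size} > 0$. If $|A| \ge C_{size}^{\frac{1}{d}}\, q^{\frac{1}{2}+\frac{1}{2(2d-1)}}$, then $$|dA^2| \ge q \cdot \frac{C_{size}^{2-\frac{1}{d}}}{C_{size}^{2-\frac{1}{d}}+1}.$$
   Context: $\mathbb{F}_q^{*}=\mathbb{F}_q\setminus\{0\}$ denotes the multiplicative group of $\mathbb{F}_q$. For $A \subset \mathbb{F}_q$, $A^2=\{a\cdot a' : a,a' \in A\}$, and $dA^2 = A^2+A^2+\dots+A^2$ ($d$ times) $=\{b_1+\dots+b_d : b_1,\dots,b_d \in A^2\}$. *)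

theory Defs
  imports Complex_Main "HOL-Library.Set_Algebras" "HOL-Library.Cardinality"
begin

text \<open>
  The set \<open>dA\<^sup>2\<close>: the \<open>d\<close>-fold sumset of the product set of \<open>A\<close> with itself.
  Product and sum are the pointwise set operations of \<^theory>\<open>HOL-Library.Set_Algebras\<close>,
  not the componentwise or Cartesian ones.
\<close>

definition sumset_of_products :: "nat \<Rightarrow> 'a::comm_semiring_1 set \<Rightarrow> 'a set" where
  "sumset_of_products d A = (\<Sum>i<d. A * A)"

lemma sumset_of_products_eq:
  "sumset_of_products d A =
     {\<Sum>i<d. b i | b. \<forall>i<d. b i \<in> {a * a' | a a'. a \<in> A \<and> a' \<in> A}}"
proof -
  have "A * A = {a * a' | a a'. a \<in> A \<and> a' \<in> A}"
    by (auto simp: set_times_def)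
  then show ?thesis
    unfolding sumset_of_products_def by (subst set_sum_alt) auto
qed

end

theory Submission imports Defs "HOL-Library.FuncSet" "HOL-Analysis.Convex" begin

text \<open>
  Write \<open>E = A\<^sup>d\<close> and \<open>\<nu>\<^sub>x(t)\<close> for the number of \<open>y\<close> in \<open>E\<close> with \<open>x \<bullet> y = t\<close>. The set \<open>dA\<^sup>2\<close> consists
  of the values of the dot product on \<open>E \<times> E\<close>, and the variance of \<open>\<nu>\<close> over the whole space is
  computed by counting points on hyperplanes, without characters. For (i), a value \<open>t \<noteq> 0\<close> that is
  missed on \<open>E \<times> E\<close> makes the variance over \<open>x\<close> of \<open>\<nu>\<^sub>x(t)\<close> too large. For (ii), the variance of \<open>\<nu>\<^sub>x\<close>
  over \<open>t\<close> depends only on the line spanned by \<open>x\<close>, and every line meets \<open>E - {0}\<close> in at most \<open>|A - {0}|\<close>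
  points, so the variance summed over \<open>E - {0}\<close> is small; the Cauchy-Schwarz inequality then bounds
  the support from below. Removing the zero vector compensates exactly for the failure of this
  bound at the degenerate line \<open>{0}\<close>.
\<close>

section \<open>Vectors with entries in a set, and the dot product\<close>

text \<open>Vectors are padded with zeros so that pointwise operations stay inside the space.\<close>

definition vecs :: "nat \<Rightarrow> 'a::zero set \<Rightarrow> (nat \<Rightarrow> 'a) set" where
  "vecs d A = {x. (\<forall>i<d. x i \<in> A) \<and> (\<forall>i\<ge>d. x i = 0)}"

definition dot :: "nat \<Rightarrow> (nat \<Rightarrow> 'a) \<Rightarrow> (nat \<Rightarrow> 'a) \<Rightarrow> 'a::comm_ring_1" where
  "dot d x y = (\<Sum>i<d. x i * y i)"

lemma bij_betw_vecs_PiE: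
  "bij_betw (\<lambda>x. restrict x {..<d}) (vecs d A) ({..<d} \<rightarrow>\<^sub>E A)"
proof (rule bij_betw_byWitness[where f' = "\<lambda>y i. if i < d then y i else 0"])
  show "\<forall>x\<in>vecs d A. (\<lambda>i. if i < d then restrict x {..<d} i else 0) = x"
    unfolding vecs_def by (intro ballI ext) simp
  show "\<forall>y\<in>{..<d} \<rightarrow>\<^sub>E A. restrict (\<lambda>i. if i < d then y i else 0) {..<d} = y"
    by (intro ballI ext) (simp add: PiE_def extensional_def restrict_def)
  show "(\<lambda>x. restrict x {..<d}) ` vecs d A \<subseteq> {..<d} \<rightarrow>\<^sub>E A"
    by (rule image_subsetI) (simp add: vecs_def)
  show "(\<lambda>y i. if i < d then y i else 0) ` ({..<d} \<rightarrow>\<^sub>E A) \<subseteq> vecs d A"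
    by (rule image_subsetI) (simp add: vecs_def PiE_iff)
qed

lemma card_vecs: "card (vecs d A) = card A ^ d"
  using bij_betw_same_card[OF bij_betw_vecs_PiE[of d A]] by (simp add: card_PiE)

lemma finite_vecs: "finite A \<Longrightarrow> finite (vecs d A)"
  using bij_betw_finite[OF bij_betw_vecs_PiE[of d A]] by (simp add: finite_PiE)

lemma vecs_mono: "A \<subseteq> B \<Longrightarrow> vecs d A \<subseteq> vecs d B"
  by (auto simp: vecs_def)

text \<open>The case \<open>d = 0\<close> is excluded because the zero vector then lies in
  \<open>vecs d A\<close> for every \<open>A\<close>.\<close>

lemma zero_mem_vecs_iff: "d \<ge> 1 \<Longrightarrow> (\<lambda>_. 0) \<in> vecs d A \<longleftrightarrow> 0 \<in> A"
  by (auto simp: vecs_def intro: exI[of _ 0])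

lemma vecs_nonzeroE:
  assumes "x \<in> vecs d A" "x \<noteq> (\<lambda>_. 0)"
  obtains i where "i < d" "x i \<noteq> 0"
proof -
  obtain i where "x i \<noteq> 0"
    using assms(2) by (auto simp: fun_eq_iff)
  moreover from this have "i < d"
    using assms(1) by (auto simp: vecs_def not_le[symmetric])
  ultimately show ?thesis by (rule that[rotated])
qed

lemma vecs_add_mem: "x \<in> vecs d UNIV \<Longrightarrow> y \<in> vecs d UNIV \<Longrightarrow> (\<lambda>i. x i + y i) \<in> vecs d UNIV"
  for x y :: "nat \<Rightarrow> 'a::comm_ring_1"
  by (simp add: vecs_def)

lemma vecs_scale_mem: "x \<in> vecs d UNIV \<Longrightarrow> (\<lambda>i. c * x i) \<in> vecs d UNIV"
  for x :: "nat \<Rightarrow> 'a::comm_ring_1"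
  by (simp add: vecs_def)

lemma dot_add_left: "dot d (\<lambda>i. x i + y i) z = dot d x z + dot d y z"
  by (simp add: dot_def algebra_simps sum.distrib)

lemma dot_diff_right: "dot d x (\<lambda>i. y i - z i) = dot d x y - dot d x z"
  by (simp add: dot_def algebra_simps sum_subtractf)

lemma dot_scale_left: "dot d (\<lambda>i. c * x i) y = c * dot d x y"
  by (simp add: dot_def algebra_simps sum_distrib_left)

lemma dot_zero_left: "dot d (\<lambda>_. 0) y = 0"
  by (simp add: dot_def)

section \<open>Point counts on hyperplanes\<close>

lemma ex_dot_eq_1:
  fixes y :: "nat \<Rightarrow> 'a::field"
  assumes "y \<in> vecs d UNIV" "y \<noteq> (\<lambda>_. 0)"
  obtains x where "x \<in> vecs d UNIV" "dot d x y = 1"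
proof -
  obtain i where i: "i < d" "y i \<noteq> 0"
    using vecs_nonzeroE[OF assms] .
  let ?x = "\<lambda>j. if j = i then inverse (y i) else 0"
  have "dot d ?x y = (\<Sum>j<d. if j = i then inverse (y i) * y i else 0)"
    unfolding dot_def by (intro sum.cong) auto
  then have "dot d ?x y = 1"
    using i by simp
  moreover have "?x \<in> vecs d UNIV"
    using i by (auto simp: vecs_def)
  ultimately show ?thesis
    by (rule that[rotated])
qed

text \<open>Translating along a vector \<open>z\<close> with \<open>dot d z y = 1\<close> changes
  the value of the dot product by any prescribed amount, so the translates of one level set
  partition the space. Multiplying by \<open>CARD('a)\<close> avoids division in
  \<open>nat\<close>.\<close>

lemma card_hyperplane:
  fixes y :: "nat \<Rightarrow> 'a::{field,finite}"
  assumes y: "y \<in> vecs d UNIV" "y \<noteq> (\<lambda>_. 0)"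
  shows "CARD('a) * card {x \<in> vecs d UNIV. dot d x y = t} = CARD('a) ^ d"
proof -
  obtain z where z: "z \<in> vecs d UNIV" "dot d z y = 1"
    using ex_dot_eq_1[OF y] .
  let ?H = "{x \<in> vecs d UNIV. dot d x y = t}"
  have "bij_betw (\<lambda>(s, x) i. s * z i + x i) (UNIV \<times> ?H) (vecs d UNIV)"
  proof (rule bij_betwI[where g = "\<lambda>x. (dot d x y - t, \<lambda>i. (t - dot d x y) * z i + x i)"],
      goal_cases)
    case 1
    then show ?case using z(1) by (auto intro!: vecs_add_mem vecs_scale_mem)
  next
    case 2
    then show ?case
      using z by (auto simp: dot_add_left dot_scale_left intro!: vecs_add_mem vecs_scale_mem)
  next
    case (3 p)
    then show ?case
      using z by (auto simp: dot_add_left dot_scale_left)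
  next
    case (4 x)
    then show ?case
      by (auto simp: algebra_simps)
  qed
  from bij_betw_same_card[OF this] show ?thesis
    by (simp add: card_cartesian_product card_vecs)
qed

text \<open>If the intersection contains a point \<open>x\<^sub>0\<close>, then \<open>x\<^sub>0\<close> and any vector separating \<open>y\<close> from \<open>y'\<close> span
  a plane whose translates of the intersection are disjoint; this needs \<open>t \<noteq> 0\<close>.\<close>

lemma card_inter_hyperplanes_le:
  fixes y y' :: "nat \<Rightarrow> 'a::{field,finite}"
  assumes y: "y \<in> vecs d UNIV" "y' \<in> vecs d UNIV" "y \<noteq> y'" and t: "t \<noteq> 0"
  shows "CARD('a)\<^sup>2 * card {x \<in> vecs d UNIV. dot d x y = t \<and> dot d x y' = t} \<le> CARD('a) ^ d"
proof -
  let ?H = "{x \<in> vecs d UNIV. dot d x y = t \<and> dot d x y' = t}"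
  show ?thesis
  proof (cases "?H = {}")
    \<comment> \<open>Linearly dependent \<open>y\<close> and \<open>y'\<close> end up here:
      distinct multiples of one vector cannot take the same nonzero value at one point. Hence only
      an inequality is claimed.\<close>
    case True
    then show ?thesis by (simp only: card.empty mult_0_right zero_le)
  next
    case False
    then obtain x0 where x0: "x0 \<in> vecs d UNIV" "dot d x0 y = t" "dot d x0 y' = t"
      by auto
    have "(\<lambda>i. y i - y' i) \<in> vecs d UNIV" "(\<lambda>i. y i - y' i) \<noteq> (\<lambda>_. 0)"
      using y by (auto simp: vecs_def fun_eq_iff)
    then obtain z where z: "z \<in> vecs d UNIV" "dot d z (\<lambda>i. y i - y' i) = 1"
      by (rule ex_dot_eq_1)
    have z1: "dot d z y = dot d z y' + 1"
      using z(2) by (simp add: dot_diff_right algebra_simps)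
    let ?f = "\<lambda>(s, r, x) i. s * x0 i + (r * z i + x i)"
    have "inj_on ?f (UNIV \<times> UNIV \<times> ?H)"
    proof (rule inj_onI)
      fix p p'
      assume p: "p \<in> UNIV \<times> UNIV \<times> ?H" "p' \<in> UNIV \<times> UNIV \<times> ?H" "?f p = ?f p'"
      obtain s r x where p1: "p = (s, r, x)" by (cases p)
      obtain s' r' x' where p2: "p' = (s', r', x')" by (cases p')
      have x: "dot d x y = t" "dot d x y' = t" "dot d x' y = t" "dot d x' y' = t"
        using p(1,2) by (simp_all add: p1 p2)
      have eq: "(\<lambda>i. s * x0 i + (r * z i + x i)) = (\<lambda>i. s' * x0 i + (r' * z i + x' i))"
        using p(3) by (simp only: p1 p2 case_prod_conv)
      \<comment> \<open>Pairing with \<open>y\<close> and with \<open>y'\<close> gives two linear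
        equations for \<open>(s, r)\<close>; by \<open>z1\<close> their determinant is
        \<open>- t\<close>.\<close>
      have 1: "s * t + r * dot d z y = s' * t + r' * dot d z y"
        using arg_cong[OF eq, of "\<lambda>v. dot d v y"] x x0 by (simp add: dot_add_left dot_scale_left)
      have 2: "s * t + r * dot d z y' = s' * t + r' * dot d z y'"
        using arg_cong[OF eq, of "\<lambda>v. dot d v y'"] x x0 by (simp add: dot_add_left dot_scale_left)
      have r: "r = r'"
        using 1 2 unfolding z1 by (simp add: distrib_left flip: add.assoc)
      then have s: "s = s'"
        using 2 t by simp
      have "x = x'"
        using eq r s by (simp add: fun_eq_iff)
      then show "p = p'"
        using p1 p2 r s by simp
    qed
    moreover have "?f ` (UNIV \<times> UNIV \<times> ?H) \<subseteq> vecs d UNIV"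
      using x0(1) z(1) by (auto intro!: vecs_add_mem vecs_scale_mem)
    ultimately have "card ((UNIV :: 'a set) \<times> (UNIV :: 'a set) \<times> ?H) \<le> card (vecs d (UNIV :: 'a set))"
      by (rule card_inj_on_le) (simp add: finite_vecs)
    then show ?thesis
      by (simp add: card_cartesian_product card_vecs power2_eq_square mult.assoc)
  qed
qed

section \<open>Moments of the fibre sizes for a fixed value\<close>

lemma sum_card_swap:
  assumes "finite X" "finite Y"
  shows "(\<Sum>x\<in>X. card {y \<in> Y. P x y}) = (\<Sum>y\<in>Y. card {x \<in> X. P x y})"
proof -
  have "(\<Sum>x\<in>X. card {y \<in> Y. P x y}) = (\<Sum>x\<in>X. \<Sum>y\<in>Y. if P x y then 1 else 0)"
    using assms by (intro sum.cong) (auto simp: sum.If_cases Int_def)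
  also have "\<dots> = (\<Sum>y\<in>Y. \<Sum>x\<in>X. if P x y then 1 else 0)"
    by (rule sum.swap)
  also have "\<dots> = (\<Sum>y\<in>Y. card {x \<in> X. P x y})"
    using assms by (intro sum.cong) (auto simp: sum.If_cases Int_def)
  finally show ?thesis .
qed

text \<open>A squared count is a count of ordered pairs; this turns second moments into intersection
  sizes.\<close>

lemma sum_card_squared_swap:
  assumes "finite X" "finite Y"
  shows "(\<Sum>x\<in>X. (card {y \<in> Y. P x y})\<^sup>2) = (\<Sum>y\<in>Y. \<Sum>y'\<in>Y. card {x \<in> X. P x y \<and> P x y'})"
proof -
  have "(card {y \<in> Y. P x y})\<^sup>2 = card {p \<in> Y \<times> Y. P x (fst p) \<and> P x (snd p)}" for x
    unfolding power2_eq_square card_cartesian_product[symmetric]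
    by (rule arg_cong[of _ _ card]) auto
  then have "(\<Sum>x\<in>X. (card {y \<in> Y. P x y})\<^sup>2)
      = (\<Sum>p\<in>Y \<times> Y. card {x \<in> X. P x (fst p) \<and> P x (snd p)})"
    using sum_card_swap[of X "Y \<times> Y" "\<lambda>x p. P x (fst p) \<and> P x (snd p)"] assms by simp
  then show ?thesis
    by (simp add: sum.cartesian_product case_prod_unfold)
qed

text \<open>This is \<open>\<nu>\<^sub>x(t)\<close> with a general \<open>Y\<close> in place of
  \<open>E\<close>: part (i) takes \<open>E\<close> without the zero vector, part (ii) takes all of
  \<open>E\<close>.\<close>

definition fibre_card :: "nat \<Rightarrow> (nat \<Rightarrow> 'a) set \<Rightarrow> (nat \<Rightarrow> 'a) \<Rightarrow> 'a::comm_ring_1 \<Rightarrow> nat" where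
  "fibre_card d Y x t = card {y \<in> Y. dot d x y = t}"

text \<open>Each \<open>y\<close> in \<open>Y\<close> contributes one hyperplane. The zero vector
  must be excluded, since \<open>dot d x y = t\<close> then defines no hyperplane.\<close>

lemma sum_fibre_card:
  fixes Y :: "(nat \<Rightarrow> 'a::{field,finite}) set"
  assumes Y: "Y \<subseteq> vecs d UNIV - {\<lambda>_. 0}"
  shows "CARD('a) * (\<Sum>x\<in>vecs d UNIV. fibre_card d Y x t) = card Y * CARD('a) ^ d"
proof -
  have fin: "finite Y"
    by (rule finite_subset[OF Y]) (simp add: finite_vecs)
  show ?thesis
    using Y fin
    by (simp add: fibre_card_def sum_card_swap[OF finite_vecs] sum_distrib_left card_hyperplane
        subset_iff)
qed

lemma sum_diagonal_split:
  fixes f :: "'b \<Rightarrow> 'b \<Rightarrow> 'c::comm_monoid_add"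
  assumes "finite Y"
  shows "(\<Sum>y\<in>Y. \<Sum>y'\<in>Y. f y y') = (\<Sum>y\<in>Y. f y y) + (\<Sum>y\<in>Y. \<Sum>y'\<in>Y - {y}. f y y')"
  using assms by (simp add: sum.distrib[symmetric] sum.remove)

text \<open>Diagonal pairs contribute a hyperplane each, off-diagonal pairs an intersection of
  two.\<close>

lemma sum_fibre_card_squared_le:
  fixes Y :: "(nat \<Rightarrow> 'a::{field,finite}) set"
  assumes Y: "Y \<subseteq> vecs d UNIV - {\<lambda>_. 0}" and t: "t \<noteq> 0"
  shows "CARD('a)\<^sup>2 * (\<Sum>x\<in>vecs d UNIV. (fibre_card d Y x t)\<^sup>2)
    \<le> card Y * CARD('a) * CARD('a) ^ d + card Y * (card Y - 1) * CARD('a) ^ d"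
proof -
  let ?q = "CARD('a)"
  let ?H = "\<lambda>y y'. card {x \<in> vecs d UNIV. dot d x y = t \<and> dot d x y' = t}"
  have fin: "finite Y"
    by (rule finite_subset[OF Y]) (simp add: finite_vecs)
  have "?q\<^sup>2 * (\<Sum>x\<in>vecs d UNIV. (fibre_card d Y x t)\<^sup>2)
      = (\<Sum>y\<in>Y. ?q * (?q * ?H y y)) + (\<Sum>y\<in>Y. \<Sum>y'\<in>Y - {y}. ?q\<^sup>2 * ?H y y')"
    unfolding fibre_card_def sum_card_squared_swap[OF finite_vecs[OF finite] fin]
      sum_diagonal_split[OF fin] conj_absorb
    by (simp add: sum_distrib_left distrib_left power2_eq_square mult.assoc)
  also have "(\<Sum>y\<in>Y. ?q * (?q * ?H y y)) = (\<Sum>y\<in>Y. ?q * ?q ^ d)"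
    using Y by (intro sum.cong) (auto simp: card_hyperplane subset_iff)
  also have "(\<Sum>y\<in>Y. \<Sum>y'\<in>Y - {y}. ?q\<^sup>2 * ?H y y') \<le> (\<Sum>y\<in>Y. \<Sum>y'\<in>Y - {y}. ?q ^ d)"
    using Y t by (intro sum_mono card_inter_hyperplanes_le) auto
  also have "(\<Sum>y\<in>Y. \<Sum>y'\<in>Y - {y}. ?q ^ d) = card Y * (card Y - 1) * ?q ^ d"
    using fin by simp
  finally show ?thesis
    by (simp add: mult.assoc)
qed

text \<open>The mean of \<open>fibre_card\<close> over \<open>x\<close> is \<open>e / q\<close>;
  scaling by \<open>q\<close> clears the denominator. The off-diagonal pairs and the mean cancel
  except for terms linear in \<open>e\<close>.\<close>

lemma fibre_variance_le:
  fixes Y :: "(nat \<Rightarrow> 'a::{field,finite}) set"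
  assumes Y: "Y \<subseteq> vecs d UNIV - {\<lambda>_. 0}" and t: "t \<noteq> 0"
  defines "q \<equiv> real CARD('a)" and "e \<equiv> real (card Y)"
  shows "(\<Sum>x\<in>vecs d UNIV. (q * real (fibre_card d Y x t) - e)\<^sup>2) \<le> e * (q - 1) * q ^ d"
proof -
  let ?S1 = "\<Sum>x\<in>vecs d UNIV. real (fibre_card d Y x t)"
  let ?S2 = "\<Sum>x\<in>vecs d UNIV. (real (fibre_card d Y x t))\<^sup>2"
  have S1: "q * ?S1 = e * q ^ d"
    using arg_cong[OF sum_fibre_card[OF Y, of t], of real] by (simp add: q_def e_def)
  have "q\<^sup>2 * ?S2 \<le> e * q * q ^ d + real (card Y * (card Y - 1)) * q ^ d"
    using sum_fibre_card_squared_le[OF Y t, THEN of_nat_mono[where 'a = real]]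
    by (simp add: q_def e_def)
  \<comment> \<open>The truncated \<open>card Y - 1\<close> differs from \<open>e - 1\<close> only
    for empty \<open>Y\<close>, where the other factor vanishes.\<close>
  also have "real (card Y * (card Y - 1)) = e * (e - 1)"
    by (cases "card Y") (auto simp: e_def algebra_simps)
  finally have S2: "q\<^sup>2 * ?S2 \<le> e * q * q ^ d + e * (e - 1) * q ^ d" .
  have "(\<Sum>x\<in>vecs d UNIV. (q * real (fibre_card d Y x t) - e)\<^sup>2)
      = (\<Sum>x\<in>vecs d UNIV. q\<^sup>2 * (real (fibre_card d Y x t))\<^sup>2 - 2 * e * (q * real (fibre_card d Y x t)) + e\<^sup>2)"
    by (intro sum.cong) (auto simp: power2_diff power_mult_distrib)
  also have "\<dots> = q\<^sup>2 * ?S2 - 2 * e * (q * ?S1) + e\<^sup>2 * real (card (vecs d (UNIV :: 'a set)))"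
    by (simp add: sum.distrib sum_subtractf sum_distrib_left)
  also have "\<dots> \<le> e * q * q ^ d + e * (e - 1) * q ^ d - 2 * e * (e * q ^ d) + e\<^sup>2 * q ^ d"
    using S1 S2 by (simp add: card_vecs q_def)
  also have "\<dots> = e * (q - 1) * q ^ d"
    by (simp add: algebra_simps power2_eq_square)
  finally show ?thesis .
qed

section \<open>Covering the nonzero elements: part (i)\<close>

lemma dot_mem_sumset_of_products:
  assumes "x \<in> vecs d A" "y \<in> vecs d A"
  shows "dot d x y \<in> sumset_of_products d A"
proof -
  have "\<forall>i<d. x i * y i \<in> {a * a' | a a'. a \<in> A \<and> a' \<in> A}"
    using assms unfolding vecs_def by blast
  then show ?thesis
    unfolding sumset_of_products_eq dot_def by (intro CollectI exI[of _ "\<lambda>i. x i * y i"]) simp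
qed

text \<open>The hypothesis is the size condition of (i) raised to the power \<open>2 * d\<close>. If
  \<open>t\<close> is missed, each of the \<open>n\<close> vectors in \<open>vecs d A\<close>
  contributes the full \<open>e\<^sup>2\<close> to the variance, exceeding
  \<open>fibre_variance_le\<close>.\<close>

lemma nonzero_subset_sumset_of_products:
  fixes A :: "'a::{field,finite} set"
  assumes size: "CARD('a) ^ (d + 1) < card A ^ (2 * d)"
  shows "UNIV - {0} \<subseteq> sumset_of_products d A"
proof (rule subsetI, rule ccontr)
  fix t assume t: "t \<in> UNIV - {0}" and miss: "t \<notin> sumset_of_products d A"
  define q where "q = real CARD('a)"
  define n where "n = real (card A) ^ d"
  define Y where "Y = vecs d A - {\<lambda>_. 0}"
  define e where "e = real (card Y)"
  have fin: "finite (vecs d A)" "finite (vecs d (UNIV :: 'a set))"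
    by (auto intro: finite_vecs)
  have Y: "Y \<subseteq> vecs d UNIV - {\<lambda>_. 0}"
    using vecs_mono[of A UNIV d] by (auto simp: Y_def)
  have q: "q \<ge> 1"
    using finite_UNIV_card_ge_0[where 'a = 'a] by (simp add: q_def)
  have "real (card A) ^ (2 * d) = n * n"
    by (simp add: n_def mult_2 power_add)
  then have "n * n > q ^ d * q"
    using size[THEN of_nat_less_iff[where 'a = real, THEN iffD2]]
    by (simp add: q_def mult.commute)
  moreover have "n \<le> q ^ d"
    unfolding n_def q_def by (intro power_mono) (auto intro: card_mono)
  \<comment> \<open>Subtracting \<open>n \<le> q ^ d\<close> from \<open>n * n > q ^ d * q\<close>
    pays exactly for replacing one factor \<open>n\<close> by \<open>n - 1\<close>, the guaranteed
    size of \<open>Y\<close>.\<close>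
  ultimately have n1: "n * (n - 1) > (q - 1) * q ^ d"
    by (simp add: algebra_simps)
  have n0: "n \<ge> 0" by (simp add: n_def)
  have "card (vecs d A) \<le> card Y + 1"
    using fin(1) by (auto simp: Y_def card_Diff_singleton_if)
  then have en: "e \<ge> n - 1"
    unfolding e_def n_def card_vecs by (simp flip: of_nat_power)
  have nu: "fibre_card d Y x t = 0" if "x \<in> vecs d A" for x
  proof -
    have "{y \<in> Y. dot d x y = t} = {}"
      using that miss dot_mem_sumset_of_products by (auto simp: Y_def)
    then show ?thesis
      by (simp only: fibre_card_def card.empty)
  qed
  have "n * e\<^sup>2 = (\<Sum>x\<in>vecs d A. (q * real (fibre_card d Y x t) - e)\<^sup>2)"
    by (simp add: nu card_vecs n_def)
  also have "\<dots> \<le> (\<Sum>x\<in>vecs d UNIV. (q * real (fibre_card d Y x t) - e)\<^sup>2)"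
    using fin by (intro sum_mono2 vecs_mono) auto
  also have "\<dots> \<le> e * (q - 1) * q ^ d"
    using fibre_variance_le[OF Y, of t] t by (simp add: q_def e_def)
  finally have *: "e * (n * e) \<le> e * ((q - 1) * q ^ d)"
    by (simp add: power2_eq_square mult_ac)
  have "n * e \<ge> n * (n - 1)"
    using en n0 by (rule mult_left_mono)
  then have **: "n * e > (q - 1) * q ^ d"
    using n1 by linarith
  moreover have "(q - 1) * q ^ d \<ge> 0" using q by simp
  ultimately have "e \<noteq> 0" by auto
  then have "e > 0" by (simp add: e_def)
  with * ** show False by (simp add: mult_le_cancel_left_pos)
qed

section \<open>Variance over the values for a fixed vector\<close>

text \<open>The squared deviations of \<open>\<nu>\<^sub>x\<close> from its mean over
  \<open>t\<close>, scaled by \<open>q\<^sup>2\<close> to avoid division.\<close>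

definition dispersion :: "nat \<Rightarrow> (nat \<Rightarrow> 'a::{comm_ring_1,finite}) set \<Rightarrow> (nat \<Rightarrow> 'a) \<Rightarrow> real" where
  "dispersion d Y x = (\<Sum>t\<in>UNIV. (real CARD('a) * real (fibre_card d Y x t) - real (card Y))\<^sup>2)"

lemma dispersion_nonneg: "dispersion d Y x \<ge> 0"
  by (simp add: dispersion_def sum_nonneg)

lemma sum_fibre_card_values:
  fixes Y :: "(nat \<Rightarrow> 'a::{comm_ring_1,finite}) set"
  assumes "finite Y"
  shows "(\<Sum>t\<in>UNIV. fibre_card d Y x t) = card Y"
  using sum_card_swap[of UNIV Y "\<lambda>t y. dot d x y = t"] assms by (simp add: fibre_card_def)

lemma dispersion_eq:
  fixes Y :: "(nat \<Rightarrow> 'a::{comm_ring_1,finite}) set"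
  assumes "finite Y"
  defines "q \<equiv> real CARD('a)" and "e \<equiv> real (card Y)"
  shows "dispersion d Y x = q\<^sup>2 * (\<Sum>t\<in>UNIV. (real (fibre_card d Y x t))\<^sup>2) - q * e\<^sup>2"
proof -
  have 1: "(\<Sum>t\<in>UNIV. real (fibre_card d Y x t)) = e"
    using arg_cong[OF sum_fibre_card_values[OF assms(1)], of real] by (simp add: e_def)
  have "dispersion d Y x = (\<Sum>t\<in>UNIV. q\<^sup>2 * (real (fibre_card d Y x t))\<^sup>2
      - 2 * e * q * real (fibre_card d Y x t) + e\<^sup>2)"
    unfolding dispersion_def q_def e_def
    by (intro sum.cong) (auto simp: power2_diff power_mult_distrib)
  also have "\<dots> = q\<^sup>2 * (\<Sum>t\<in>UNIV. (real (fibre_card d Y x t))\<^sup>2) - 2 * e * q * e + q * e\<^sup>2"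
    by (simp add: sum.distrib sum_subtractf q_def flip: sum_distrib_left 1)
  finally show ?thesis
    by (simp add: power2_eq_square)
qed

text \<open>Multiplying \<open>x\<close> by \<open>s\<close> only permutes the values
  \<open>t\<close>, so the dispersion is constant along a line with the origin removed.\<close>

lemma dispersion_scale:
  fixes Y :: "(nat \<Rightarrow> 'a::{field,finite}) set"
  assumes "s \<noteq> 0"
  shows "dispersion d Y (\<lambda>i. s * x i) = dispersion d Y x"
proof -
  have bij: "bij_betw (\<lambda>t. s * t) UNIV UNIV"
    by (rule bij_betw_byWitness[where f' = "\<lambda>t. t / s"]) (use assms in auto)
  have "fibre_card d Y (\<lambda>i. s * x i) (s * t) = fibre_card d Y x t" for t
    using assms by (simp add: fibre_card_def dot_scale_left)
  then show ?thesis
    unfolding dispersion_def by (subst sum.reindex_bij_betw[OF bij, symmetric]) simp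
qed

text \<open>All of \<open>Y\<close> lies in the single fibre over \<open>0\<close>.\<close>

lemma dispersion_zero:
  fixes Y :: "(nat \<Rightarrow> 'a::{comm_ring_1,finite}) set"
  assumes "finite Y"
  defines "q \<equiv> real CARD('a)" and "e \<equiv> real (card Y)"
  shows "dispersion d Y (\<lambda>_. 0) = q * (q - 1) * e\<^sup>2"
proof -
  have "(real (fibre_card d Y (\<lambda>_. 0) t))\<^sup>2 = (if t = 0 then e\<^sup>2 else 0)" for t
    by (simp add: fibre_card_def dot_zero_left e_def)
  then show ?thesis
    unfolding dispersion_eq[OF assms(1)]
    by (simp add: algebra_simps power2_eq_square q_def e_def)
qed

lemma card_equal_dots:
  fixes y y' :: "nat \<Rightarrow> 'a::{field,finite}"
  assumes "y \<in> vecs d UNIV" "y' \<in> vecs d UNIV" "y \<noteq> y'"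
  shows "CARD('a) * card {x \<in> vecs d UNIV. dot d x y = dot d x y'} = CARD('a) ^ d"
proof -
  have "(\<lambda>i. y i - y' i) \<in> vecs d UNIV" "(\<lambda>i. y i - y' i) \<noteq> (\<lambda>_. 0)"
    using assms by (auto simp: vecs_def fun_eq_iff)
  from card_hyperplane[OF this, of 0] show ?thesis
    by (simp add: dot_diff_right)
qed

text \<open>Summing over all \<open>t\<close> leaves the condition that \<open>x\<close> is
  orthogonal to \<open>y - y'\<close>, a genuine hyperplane for distinct \<open>y\<close> and
  \<open>y'\<close>. Hence equality holds, and \<open>Y\<close> may contain the zero vector.\<close>

lemma sum_fibre_card_squared_eq:
  fixes Y :: "(nat \<Rightarrow> 'a::{field,finite}) set"
  assumes Y: "Y \<subseteq> vecs d UNIV"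
  shows "CARD('a) * (\<Sum>x\<in>vecs d UNIV. \<Sum>t\<in>UNIV. (fibre_card d Y x t)\<^sup>2)
    = card Y * CARD('a) * CARD('a) ^ d + card Y * (card Y - 1) * CARD('a) ^ d"
proof -
  let ?q = "CARD('a)" and ?V = "vecs d (UNIV :: 'a set)"
  let ?H = "\<lambda>y y'. card {x \<in> ?V. dot d x y = dot d x y'}"
  have fin: "finite Y"
    by (rule finite_subset[OF Y]) (simp add: finite_vecs)
  \<comment> \<open>The component \<open>t\<close> is determined by \<open>x\<close>, so projecting
    to \<open>x\<close> loses nothing.\<close>
  have H: "card {p \<in> ?V \<times> UNIV. dot d (fst p) y = snd p \<and> dot d (fst p) y' = snd p} = ?H y y'" for y y'
  proof -
    have "{p \<in> ?V \<times> UNIV. dot d (fst p) y = snd p \<and> dot d (fst p) y' = snd p}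
        = (\<lambda>x. (x, dot d x y)) ` {x \<in> ?V. dot d x y = dot d x y'}"
      by force
    then show ?thesis
      by (simp add: card_image inj_on_def)
  qed
  have "(\<Sum>x\<in>?V. \<Sum>t\<in>UNIV. (fibre_card d Y x t)\<^sup>2)
      = (\<Sum>p\<in>?V \<times> UNIV. (card {y \<in> Y. dot d (fst p) y = snd p})\<^sup>2)"
    by (simp add: fibre_card_def sum.cartesian_product case_prod_unfold)
  also have "\<dots> = (\<Sum>y\<in>Y. \<Sum>y'\<in>Y. ?H y y')"
    using fin by (subst sum_card_squared_swap) (simp_all add: finite_vecs H)
  also have "\<dots> = card Y * ?q ^ d + (\<Sum>y\<in>Y. \<Sum>y'\<in>Y - {y}. ?H y y')"
    unfolding sum_diagonal_split[OF fin] by (simp add: card_vecs)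
  finally have "?q * (\<Sum>x\<in>?V. \<Sum>t\<in>UNIV. (fibre_card d Y x t)\<^sup>2)
      = card Y * ?q * ?q ^ d + (\<Sum>y\<in>Y. \<Sum>y'\<in>Y - {y}. ?q * ?H y y')"
    by (simp add: distrib_left sum_distrib_left)
  also have "(\<Sum>y\<in>Y. \<Sum>y'\<in>Y - {y}. ?q * ?H y y') = (\<Sum>y\<in>Y. \<Sum>y'\<in>Y - {y}. ?q ^ d)"
    using Y by (intro sum.cong refl card_equal_dots) auto
  also have "\<dots> = card Y * (card Y - 1) * ?q ^ d"
    using fin by simp
  finally show ?thesis .
qed

text \<open>The sum over the whole space is \<open>q * (q - 1) * (e * q ^ d)\<close>; the term at
  the zero vector is then subtracted.\<close>

lemma sum_dispersion:
  fixes Y :: "(nat \<Rightarrow> 'a::{field,finite}) set"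
  assumes Y: "Y \<subseteq> vecs d UNIV"
  defines "q \<equiv> real CARD('a)" and "e \<equiv> real (card Y)"
  shows "(\<Sum>x\<in>vecs d UNIV - {\<lambda>_. 0}. dispersion d Y x) = q * (q - 1) * (e * (q ^ d - e))"
proof -
  let ?V = "vecs d (UNIV :: 'a set)"
  let ?S2 = "\<Sum>x\<in>?V. \<Sum>t\<in>UNIV. (real (fibre_card d Y x t))\<^sup>2"
  have fin: "finite Y"
    by (rule finite_subset[OF Y]) (simp add: finite_vecs)
  have "q * ?S2 = e * q * q ^ d + real (card Y * (card Y - 1)) * q ^ d"
    using arg_cong[OF sum_fibre_card_squared_eq[OF Y], of real] by (simp add: q_def e_def)
  also have "real (card Y * (card Y - 1)) = e * (e - 1)"
    by (cases "card Y") (auto simp: e_def algebra_simps)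
  finally have S2: "q * ?S2 = e * q * q ^ d + e * (e - 1) * q ^ d" .
  have "(\<Sum>x\<in>?V. dispersion d Y x) = q\<^sup>2 * ?S2 - q ^ d * (q * e\<^sup>2)"
    by (simp add: dispersion_eq[OF fin] sum_subtractf card_vecs q_def e_def flip: sum_distrib_left)
  also have "\<dots> = q * (e * q * q ^ d + e * (e - 1) * q ^ d) - q ^ d * (q * e\<^sup>2)"
    unfolding S2[symmetric] by (simp add: power2_eq_square)
  finally have "(\<Sum>x\<in>?V. dispersion d Y x) = q * (q - 1) * (e * q ^ d)"
    by (simp add: algebra_simps power2_eq_square)
  moreover have "(\<Sum>x\<in>?V. dispersion d Y x)
      = dispersion d Y (\<lambda>_. 0) + (\<Sum>x\<in>?V - {\<lambda>_. 0}. dispersion d Y x)"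
    by (rule sum.remove) (auto simp: finite_vecs, simp add: vecs_def)
  moreover have "dispersion d Y (\<lambda>_. 0) = q * (q - 1) * e\<^sup>2"
    unfolding q_def e_def by (rule dispersion_zero[OF fin])
  ultimately show ?thesis
    by (simp add: right_diff_distrib power2_eq_square)
qed

section \<open>Averaging over lines through the origin\<close>

text \<open>At a coordinate \<open>j\<close> with \<open>v j \<noteq> 0\<close>, the entry of the
  vector lies in \<open>A - {0}\<close> and determines the scalar, hence the whole pair.\<close>

lemma card_scalings_le:
  fixes A :: "'a::{field,finite} set"
  assumes v: "v \<in> vecs d UNIV - {\<lambda>_. 0}"
  shows "card {p \<in> (UNIV - {0}) \<times> (vecs d A - {\<lambda>_. 0}). (\<lambda>i. fst p * snd p i) = v} \<le> card (A - {0})"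
proof -
  obtain j where j: "j < d" "v j \<noteq> 0"
    using vecs_nonzeroE v by blast
  let ?P = "{p \<in> (UNIV - {0}) \<times> (vecs d A - {\<lambda>_. 0}). (\<lambda>i. fst p * snd p i) = v}"
  have P: "fst p * snd p i = v i" if "p \<in> ?P" for p i
    using that by (auto simp: fun_eq_iff)
  have "inj_on (\<lambda>p. snd p j) ?P"
  proof (rule inj_onI)
    fix p p' assume p: "p \<in> ?P" "p' \<in> ?P" "snd p j = snd p' j"
    have "fst p * snd p j = fst p' * snd p j"
      using P[OF p(1), of j] P[OF p(2), of j] p(3) by simp
    moreover have "snd p j \<noteq> 0"
      using P[OF p(1), of j] j(2) by auto
    ultimately have 1: "fst p = fst p'"
      by simp
    have "fst p \<noteq> 0"
      using p(1) by auto
    then have "snd p i = snd p' i" for i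
      using P[OF p(1), of i] P[OF p(2), of i] 1 by (metis mult_left_cancel)
    then show "p = p'"
      using 1 by (intro prod_eqI ext)
  qed
  moreover have "(\<lambda>p. snd p j) ` ?P \<subseteq> A - {0}"
  proof (rule image_subsetI)
    fix p assume p: "p \<in> ?P"
    have "snd p j \<noteq> 0"
      using P[OF p, of j] j(2) by auto
    moreover have "snd p \<in> vecs d A"
      using p by auto
    ultimately show "snd p j \<in> A - {0}"
      using j(1) by (simp add: vecs_def)
  qed
  ultimately show ?thesis
    by (rule card_inj_on_le) simp
qed

lemma card_field_ge_2: "CARD('a::{field,finite}) \<ge> 2"
  using card_mono[of UNIV "{0, 1 :: 'a}"] by simp

lemma sum_dispersion_le:
  fixes A :: "'a::{field,finite} set" and Y :: "(nat \<Rightarrow> 'a) set"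
  assumes Y: "Y \<subseteq> vecs d UNIV"
  defines "q \<equiv> real CARD('a)" and "e \<equiv> real (card Y)"
  shows "(\<Sum>x\<in>vecs d A - {\<lambda>_. 0}. dispersion d Y x) \<le> real (card (A - {0})) * (q * (e * (q ^ d - e)))"
proof -
  let ?X = "vecs d A - {\<lambda>_. 0}" and ?V = "vecs d (UNIV :: 'a set) - {\<lambda>_. 0}"
  let ?f = "\<lambda>p::'a \<times> (nat \<Rightarrow> 'a). \<lambda>i. fst p * snd p i"
  let ?D = "dispersion d Y"
  let ?U = "UNIV - {0 :: 'a}"
  let ?m = "real (card (A - {0}))"
  have q: "q \<ge> 2"
    using card_field_ge_2[where 'a = 'a] by (simp add: q_def)
  have fin: "finite ?X" "finite ?V"
    by (simp_all add: finite_vecs)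
  have f: "?f ` (?U \<times> ?X) \<subseteq> ?V"
  proof (rule image_subsetI)
    fix p assume p: "p \<in> ?U \<times> ?X"
    then have "snd p \<in> vecs d UNIV" "fst p \<noteq> 0" "snd p \<noteq> (\<lambda>_. 0)"
      using vecs_mono[of A UNIV d] by auto
    then show "?f p \<in> ?V"
      using vecs_scale_mem[of "snd p" d "fst p"] by (simp add: fun_eq_iff)
  qed
  have "card ?U = CARD('a) - 1"
    by (simp add: card_Diff_singleton)
  \<comment> \<open>Each vector is replaced by its \<open>q - 1\<close> nonzero multiples, all of
    the same dispersion; the factor \<open>q - 1\<close> cancels against
    \<open>sum_dispersion\<close>.\<close>
  then have "(q - 1) * (\<Sum>x\<in>?X. ?D x) = (\<Sum>s\<in>?U. \<Sum>x\<in>?X. ?D x)"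
    using q by (simp add: q_def of_nat_diff)
  also have "\<dots> = (\<Sum>s\<in>?U. \<Sum>x\<in>?X. ?D (\<lambda>i. s * x i))"
    by (intro sum.cong) (simp_all add: dispersion_scale)
  also have "\<dots> = (\<Sum>p\<in>?U \<times> ?X. ?D (?f p))"
    by (simp add: sum.cartesian_product case_prod_unfold)
  \<comment> \<open>Grouping by the product \<open>v\<close> exposes the multiplicities bounded in
    \<open>card_scalings_le\<close>.\<close>
  also have "\<dots> = (\<Sum>v\<in>?V. \<Sum>p\<in>{p \<in> ?U \<times> ?X. ?f p = v}. ?D (?f p))"
    using f fin by (intro sum.group[symmetric]) simp_all
  also have "\<dots> = (\<Sum>v\<in>?V. real (card {p \<in> ?U \<times> ?X. ?f p = v}) * ?D v)"
    by (intro sum.cong refl) simp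
  also have "\<dots> \<le> (\<Sum>v\<in>?V. ?m * ?D v)"
    by (intro sum_mono mult_right_mono dispersion_nonneg of_nat_mono card_scalings_le)
  also have "\<dots> = (q - 1) * (?m * (q * (e * (q ^ d - e))))"
    unfolding sum_distrib_left[symmetric] sum_dispersion[OF Y] q_def e_def by (simp add: mult_ac)
  finally show ?thesis
    using q by simp
qed

section \<open>Cauchy-Schwarz and the size of the support: part (ii)\<close>

text \<open>Cauchy-Schwarz on \<open>(vecs d A - {0}) \<times> T\<close>: the fibre sizes sum to
  \<open>k * n\<close> there, and their squares are controlled by the summed dispersion.\<close>

lemma support_bound:
  fixes A T :: "'a::{field,finite} set"
  assumes T: "\<And>x y. x \<in> vecs d A \<Longrightarrow> y \<in> vecs d A \<Longrightarrow> dot d x y \<in> T"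
  defines "q \<equiv> real CARD('a)" and "n \<equiv> real (card A) ^ d"
    and "k \<equiv> real (card (vecs d A - {\<lambda>_. 0}))" and "m \<equiv> real (card (A - {0}))"
  shows "q * n * k \<le> real (card T) * (m * (q ^ d - n) + k * n)"
proof -
  let ?X = "vecs d A - {\<lambda>_. 0}" and ?Y = "vecs d A"
  let ?g = "\<lambda>x t. real (fibre_card d ?Y x t)"
  have Y: "?Y \<subseteq> vecs d UNIV"
    by (rule vecs_mono) simp
  have fin: "finite ?X" "finite ?Y"
    by (simp_all add: finite_vecs)
  have n: "real (card ?Y) = n"
    by (simp add: card_vecs n_def)
  have q: "q \<ge> 2"
    using card_field_ge_2[where 'a = 'a] by (simp add: q_def)
  have outside: "?g x t = 0" if "x \<in> ?X" "t \<notin> T" for x t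
  proof -
    have "{y \<in> ?Y. dot d x y = t} = {}"
      using that T by blast
    then show ?thesis
      by (simp only: fibre_card_def card.empty of_nat_0)
  qed
  have S1: "(\<Sum>t\<in>T. ?g x t) = n" if "x \<in> ?X" for x
  proof -
    have "(\<Sum>t\<in>T. ?g x t) = (\<Sum>t\<in>UNIV. ?g x t)"
      using outside[OF that] by (intro sum.mono_neutral_left) auto
    then show ?thesis
      using sum_fibre_card_values[OF fin(2), of d x] by (simp add: n flip: of_nat_sum)
  qed
  have S2: "q\<^sup>2 * (\<Sum>t\<in>T. (?g x t)\<^sup>2) = dispersion d ?Y x + q * n\<^sup>2" if "x \<in> ?X" for x
  proof -
    have "(\<Sum>t\<in>T. (?g x t)\<^sup>2) = (\<Sum>t\<in>UNIV. (?g x t)\<^sup>2)"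
      using outside[OF that] by (intro sum.mono_neutral_left) auto
    then show ?thesis
      unfolding dispersion_eq[OF fin(2)] n q_def by simp
  qed
  have "(\<Sum>p\<in>?X \<times> T. ?g (fst p) (snd p)) = (\<Sum>x\<in>?X. \<Sum>t\<in>T. ?g x t)"
    by (simp add: sum.cartesian_product case_prod_unfold)
  also have "\<dots> = (\<Sum>x\<in>?X. n)"
    by (intro sum.cong refl S1)
  finally have "(\<Sum>p\<in>?X \<times> T. ?g (fst p) (snd p)) = k * n"
    by (simp add: k_def)
  then have "(k * n)\<^sup>2 \<le> real (card (?X \<times> T)) * (\<Sum>p\<in>?X \<times> T. (?g (fst p) (snd p))\<^sup>2)"
    using sum_squared_le_sum_of_squares[of "\<lambda>p. ?g (fst p) (snd p)" "?X \<times> T"] by (simp add: mult.commute)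
  also have "\<dots> = k * real (card T) * (\<Sum>x\<in>?X. \<Sum>t\<in>T. (?g x t)\<^sup>2)"
    by (simp add: k_def card_cartesian_product case_prod_unfold sum.cartesian_product)
  finally have cs: "q\<^sup>2 * (k * n)\<^sup>2 \<le> k * real (card T) * (q\<^sup>2 * (\<Sum>x\<in>?X. \<Sum>t\<in>T. (?g x t)\<^sup>2))"
    using q by (simp add: mult.left_commute)
  have "q\<^sup>2 * (\<Sum>x\<in>?X. \<Sum>t\<in>T. (?g x t)\<^sup>2) = (\<Sum>x\<in>?X. dispersion d ?Y x + q * n\<^sup>2)"
    by (subst sum_distrib_left) (intro sum.cong refl S2)
  also have "\<dots> = (\<Sum>x\<in>?X. dispersion d ?Y x) + k * (q * n\<^sup>2)"
    by (simp add: sum.distrib k_def)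
  also have "\<dots> \<le> m * (q * (n * (q ^ d - n))) + k * (q * n\<^sup>2)"
    using sum_dispersion_le[OF Y, of A] by (simp add: n q_def m_def)
  finally have "k * real (card T) * (q\<^sup>2 * (\<Sum>x\<in>?X. \<Sum>t\<in>T. (?g x t)\<^sup>2))
      \<le> k * real (card T) * (m * (q * (n * (q ^ d - n))) + k * (q * n\<^sup>2))"
    by (rule mult_left_mono) (simp add: k_def)
  with cs have "q\<^sup>2 * (k * n)\<^sup>2 \<le> k * real (card T) * (m * (q * (n * (q ^ d - n))) + k * (q * n\<^sup>2))"
    by (rule order_trans)
  then have "(k * n * q) * (q * n * k) \<le> (k * n * q) * (real (card T) * (m * (q ^ d - n) + k * n))"
    by (simp add: algebra_simps power2_eq_square)
  moreover have "k * n * q \<ge> 0"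
    using q by (simp add: k_def n_def)
  \<comment> \<open>The factor \<open>k * n * q\<close> cannot be cancelled when it is zero, but
    then the left side is zero too.\<close>
  moreover have "q * n * k \<le> real (card T) * (m * (q ^ d - n) + k * n)" if "k * n * q = 0"
  proof -
    have "n \<le> q ^ d"
      unfolding n_def q_def by (intro power_mono) (auto intro: card_mono)
    then have "0 \<le> real (card T) * (m * (q ^ d - n) + k * n)"
      by (simp add: m_def k_def n_def)
    then show ?thesis
      using that by auto
  qed
  ultimately show ?thesis
    by (cases "k * n * q = 0") (simp_all add: mult_le_cancel_left)
qed

text \<open>Here \<open>c\<close> stands for \<open>C powr (2 - 1 / d)\<close>, and the size
  condition of (ii) has been raised to the power \<open>2 * d - 1\<close>.\<close>

lemma card_sumset_of_products_ge:
  fixes A :: "'a::{field,finite} set"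
  assumes d: "d \<ge> 1" and c: "c > 0" and size: "c * real CARD('a) ^ d \<le> real (card A) ^ (2 * d - 1)"
  shows "c * real CARD('a) \<le> real (card (sumset_of_products d A)) * (c + 1)"
proof -
  define q where "q = real CARD('a)"
  define a where "a = real (card A)"
  define n where "n = a ^ d"
  define k where "k = real (card (vecs d A - {\<lambda>_. 0}))"
  define m where "m = real (card (A - {0}))"
  define \<tau> where "\<tau> = real (card (sumset_of_products d A))"
  have bound: "q * n * k \<le> \<tau> * (m * (q ^ d - n) + k * n)"
    unfolding q_def n_def a_def k_def m_def \<tau>_def
    by (rule support_bound) (rule dot_mem_sumset_of_products)
  have q: "q \<ge> 2"
    using card_field_ge_2[where 'a = 'a] by (simp add: q_def)
  have size': "c * q ^ d \<le> a ^ (2 * d - 1)"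
    using size by (simp add: q_def a_def)
  moreover have "c * q ^ d > 0"
    using c q by simp
  ultimately have "a \<noteq> 0"
    using d by (auto simp: power_0_left split: if_splits)
  then have "card A \<noteq> 0"
    by (simp add: a_def)
  then have a: "a \<ge> 1" and A: "A \<noteq> {}"
    by (cases "card A"; auto simp: a_def)+
  have a_le_n: "a \<le> n"
    using power_increasing[OF d a] by (simp add: n_def)
  have k0: "k \<ge> 0" and m0: "m \<ge> 0" and \<tau>0: "\<tau> \<ge> 0"
    by (simp_all add: k_def m_def \<tau>_def)
  have mk: "m = a \<and> k = n \<or> 0 \<in> A \<and> m = a - 1 \<and> k = n - 1"
  proof (cases "0 \<in> A")
    case True
    then have "(\<lambda>_. 0) \<in> vecs d A"
      using d by (simp add: zero_mem_vecs_iff)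
    moreover have "card A \<ge> 1"
      using a by (simp add: a_def)
    moreover from this have "card (vecs d A) \<ge> 1"
      unfolding card_vecs by (rule one_le_power)
    ultimately have "k = real (card (vecs d A)) - 1" "m = a - 1"
      using True by (simp_all add: k_def m_def a_def card_Diff_singleton of_nat_diff)
    then show ?thesis
      using True by (simp add: card_vecs n_def a_def)
  next
    case False
    then have "(\<lambda>_. 0) \<notin> vecs d A"
      using d by (simp add: zero_mem_vecs_iff)
    then show ?thesis
      using False by (simp add: k_def m_def n_def a_def card_vecs)
  qed
  \<comment> \<open>If \<open>0 \<in> A\<close>, this reads
    \<open>(a - 1) * n \<le> a * (n - 1)\<close>, that is, \<open>a \<le> n\<close>; otherwise it is
    an equality. Removing zero thus costs nothing.\<close>
  have "m * n \<le> a * k"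
    using mk a_le_n by (auto simp: algebra_simps)
  have n2: "a * a ^ (2 * d - 1) = n * n"
    using d by (simp add: n_def flip: power_Suc power_add mult_2)
  have "a * (m * a ^ (2 * d - 1)) = m * n * n"
    using n2 by (simp add: mult.left_commute mult.assoc)
  also have "\<dots> \<le> a * k * n"
    using \<open>m * n \<le> a * k\<close> a_le_n a by (intro mult_right_mono) auto
  finally have "a * (m * a ^ (2 * d - 1)) \<le> a * (k * n)"
    by (simp add: mult.assoc)
  then have main: "m * a ^ (2 * d - 1) \<le> k * n"
    using a by simp
  have "c * (q ^ d - n) \<le> c * q ^ d"
    using c a a_le_n by simp
  then have "c * (q ^ d - n) \<le> a ^ (2 * d - 1)"
    using size' by linarith
  \<comment> \<open>So \<open>c\<close> times the dispersion term is at most the main term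
    \<open>k * n\<close>; this produces the denominator \<open>c + 1\<close>.\<close>
  then have "m * (c * (q ^ d - n)) \<le> k * n"
    using main m0 mult_left_mono[of "c * (q ^ d - n)" "a ^ (2 * d - 1)" m] by linarith
  have "(k * n) * (c * q) = c * (q * n * k)"
    by simp
  also have "\<dots> \<le> c * (\<tau> * (m * (q ^ d - n) + k * n))"
    using bound c by (intro mult_left_mono) auto
  also have "\<dots> = \<tau> * (m * (c * (q ^ d - n)) + c * (k * n))"
    by (simp add: algebra_simps)
  also have "\<dots> \<le> \<tau> * (k * n + c * (k * n))"
    using \<open>m * (c * (q ^ d - n)) \<le> k * n\<close> \<tau>0 by (intro mult_left_mono) auto
  also have "\<dots> = (k * n) * (\<tau> * (c + 1))"
    by (simp add: algebra_simps)
  finally have fin: "(k * n) * (c * q) \<le> (k * n) * (\<tau> * (c + 1))" .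
  show ?thesis
  proof (cases "k = 0")
    case False
    then have "k * n > 0"
      using k0 a a_le_n by (simp add: zero_less_mult_iff)
    with fin have "c * q \<le> \<tau> * (c + 1)"
      by (simp only: mult_le_cancel_left_pos)
    then show ?thesis
      by (simp add: \<tau>_def q_def)
  next
    \<comment> \<open>This is \<open>A = {0}\<close>: the size hypothesis forces
      \<open>c * q \<le> 1\<close>, and a nonempty sumset suffices.\<close>
    case True
    then have "a = 1"
      using mk a a_le_n by auto
    then have "c * q ^ d \<le> 1"
      using size' by simp
    moreover have "c * q \<le> c * q ^ d"
      using power_increasing[OF d, of q] q c by simp
    ultimately have "c * q \<le> 1"
      by (rule order_trans[rotated])
    have "sumset_of_products d A \<noteq> {}"
    proof -
      obtain x where "x \<in> A"
        using A by blast
      then have "(\<lambda>i. if i < d then x else 0) \<in> vecs d A"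
        by (simp add: vecs_def)
      then show ?thesis
        using dot_mem_sumset_of_products by blast
    qed
    then have "\<tau> \<ge> 1"
      by (simp add: \<tau>_def Suc_le_eq card_gt_0_iff)
    then have "1 * (c + 1) \<le> \<tau> * (c + 1)"
      using c by (intro mult_right_mono) auto
    moreover have "c * q \<le> 1 * (c + 1)"
      using \<open>c * q \<le> 1\<close> c by simp
    ultimately have "c * q \<le> \<tau> * (c + 1)"
      by (rule order_trans[rotated])
    then show ?thesis
      by (simp add: \<tau>_def q_def)
  qed
qed

section \<open>From real exponents to integer powers\<close>

theorem theorem1p1:
  fixes A :: "'a::{field,finite} set" and d q :: nat
  assumes q: "q = CARD('a)"
    and d: "d \<ge> 1"
  shows "(real (card A) > real q powr (1 / 2 + 1 / (2 * real d))
            \<longrightarrow> UNIV - {0} \<subseteq> sumset_of_products d A)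
       \<and> (\<forall>C::real. C > 0
            \<longrightarrow> real (card A) \<ge> C powr (1 / real d) * real q powr (1 / 2 + 1 / (2 * (2 * real d - 1)))
            \<longrightarrow> real (card (sumset_of_products d A))
                  \<ge> real q * (C powr (2 - 1 / real d) / (C powr (2 - 1 / real d) + 1)))"
proof (intro conjI impI allI)
  have q0: "real q > 0"
    using card_field_ge_2[where 'a = 'a] by (simp add: q)
  assume "real (card A) > real q powr (1 / 2 + 1 / (2 * real d))"
  \<comment> \<open>The power \<open>2 * d\<close> clears the denominators of the exponent, leaving
    \<open>d + 1\<close>.\<close>
  then have "real (card A) ^ (2 * d) > (real q powr (1 / 2 + 1 / (2 * real d))) ^ (2 * d)"
    using d by (intro power_strict_mono) auto
  also have "(real q powr (1 / 2 + 1 / (2 * real d))) ^ (2 * d)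
      = real q powr (real (2 * d) * (1 / 2 + 1 / (2 * real d)))"
    by (rule powr_power) (use q0 in simp)
  also have "real (2 * d) * (1 / 2 + 1 / (2 * real d)) = real (d + 1)"
    using d by (simp add: field_simps)
  also have "real q powr real (d + 1) = real q ^ (d + 1)"
    using q0 by (rule powr_realpow)
  finally have "q ^ (d + 1) < card A ^ (2 * d)"
    by (simp only: of_nat_less_iff flip: of_nat_power)
  then show "UNIV - {0} \<subseteq> sumset_of_products d A"
    unfolding q by (rule nonzero_subset_sumset_of_products)
next
  fix C :: real
  assume C: "C > 0"
    and size: "real (card A) \<ge> C powr (1 / real d) * real q powr (1 / 2 + 1 / (2 * (2 * real d - 1)))"
  have q0: "real q > 0"
    using card_field_ge_2[where 'a = 'a] by (simp add: q)
  define c where "c = C powr (2 - 1 / real d)"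
  have c: "c > 0"
    using C by (simp add: c_def)
  have d': "real (2 * d - 1) = 2 * real d - 1"
    using d by (simp add: of_nat_diff)
  \<comment> \<open>The power \<open>2 * d - 1\<close> turns the exponent of \<open>q\<close> into
    \<open>d\<close> and that of \<open>C\<close> into \<open>2 - 1 / d\<close>.\<close>
  have "(C powr (1 / real d)) ^ (2 * d - 1) = C powr (real (2 * d - 1) * (1 / real d))"
    by (rule powr_power) (use C in simp)
  also have "real (2 * d - 1) * (1 / real d) = 2 - 1 / real d"
    unfolding d' using d by (simp add: field_simps)
  finally have "(C powr (1 / real d)) ^ (2 * d - 1) = c"
    by (simp only: c_def)
  moreover have "(real q powr (1 / 2 + 1 / (2 * (2 * real d - 1)))) ^ (2 * d - 1) = real q ^ d"
  proof -
    have "(real q powr (1 / 2 + 1 / (2 * (2 * real d - 1)))) ^ (2 * d - 1)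
        = real q powr (real (2 * d - 1) * (1 / 2 + 1 / (2 * (2 * real d - 1))))"
      by (rule powr_power) (use q0 in simp)
    also have "real (2 * d - 1) * (1 / 2 + 1 / (2 * (2 * real d - 1))) = real d"
      unfolding d' using d by (simp add: field_simps)
    also have "real q powr real d = real q ^ d"
      using q0 by (rule powr_realpow)
    finally show ?thesis .
  qed
  ultimately have "c * real q ^ d
      = (C powr (1 / real d) * real q powr (1 / 2 + 1 / (2 * (2 * real d - 1)))) ^ (2 * d - 1)"
    by (simp add: power_mult_distrib)
  also have "\<dots> \<le> real (card A) ^ (2 * d - 1)"
    using size by (intro power_mono) auto
  finally have "c * real q \<le> real (card (sumset_of_products d A)) * (c + 1)"
    using card_sumset_of_products_ge[OF d c, of A] by (simp add: q)
  then show "real (card (sumset_of_products d A))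
      \<ge> real q * (C powr (2 - 1 / real d) / (C powr (2 - 1 / real d) + 1))"
    using c by (simp add: c_def[symmetric] field_simps)
qed

end
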